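(* Let $n\ge 2$, let $x_1,\dots,x_n\in\mathbb{R}^{p,q}$ be any $n$ points, and let $\varepsilon\in(0,1)$. Then there exist integers $p',q'=O(\log n/\varepsilon^2)$ (i.e. $p',q'\le K\log n/\varepsilon^2$ for an absolute constant $K$) and a map $f:\mathbb{R}^{p,q}\to\mathbb{R}^{p',q'}$ such that for all $i,j\in[n]$ with $\|x_i-x_j\|_{p,q}^2\neq 0$, $$\Big|\,\|f(x_i)-f(x_j)\|_{p',q'}^2-\|x_i-x_j\|_{p,q}^2\,\Big|\;\le\;\varepsilon\, C_{ij}\,\big|\|x_i-x_j\|_{p,q}^2\big|,$$ where $C_{ij}=\left|\frac{\|x_i-x_j\|_E^2}{\|x_i-x_j\|_{p,q}^2}\right|$. Equivalently, $\|f(x_i)-f(x_j)\|_{p',q'}^2$ lies between $(1-\varepsilon C_{ij})\|x_i-x_j\|_{p,q}^2$ and $(1+\varepsilon C_{ij})\|x_i-x_j\|_{p,q}^2$.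
   Context: For nonnegative integers $p,q$, $\mathbb{R}^{p,q}$ denotes $\mathbb{R}^{p+q}$ equipped with the symmetric bilinear form $\langle u,v\rangle=\sum_{i=1}^p u_iv_i-\sum_{i=p+1}^{p+q}u_iv_i$. For $v\in\mathbb{R}^{p,q}$, $\|v\|_{p,q}^2:=\langle v,v\rangle$ (which may be negative), and $\|v\|_E^2:=\sum_{i=1}^{p+q}v_i^2$ is the squared Euclidean norm. Similarly $\|\cdot\|_{p',q'}^2$ is the corresponding form on $\mathbb{R}^{p',q'}$. *)

theory Defs
  imports "Jordan_Normal_Form.Matrix"
begin

text \<open>
  The space $\mathbb{R}^{p,q}$ has carrier \<open>carrier_vec (p + q)\<close>. Coordinates are 0-based, so the
  \<open>p\<close> positive ones are those below \<open>p\<close> and the \<open>q\<close> negative ones are those in \<open>{p..<p + q}\<close>.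
\<close>

definition pq_space :: "nat \<Rightarrow> nat \<Rightarrow> real Matrix.vec set" where
  "pq_space p q = carrier_vec (p + q)"

definition pq_form :: "nat \<Rightarrow> nat \<Rightarrow> real Matrix.vec \<Rightarrow> real Matrix.vec \<Rightarrow> real" where
  "pq_form p q u v = (\<Sum>i<p. u $ i * v $ i) - (\<Sum>i=p..<p + q. u $ i * v $ i)"

definition pq_sqnorm :: "nat \<Rightarrow> nat \<Rightarrow> real Matrix.vec \<Rightarrow> real" where
  "pq_sqnorm p q v = pq_form p q v v"

definition euclid_sqnorm :: "real Matrix.vec \<Rightarrow> real" where
  "euclid_sqnorm v = (\<Sum>i<dim_vec v. (v $ i)\<^sup>2)"

definition distortion :: "nat \<Rightarrow> nat \<Rightarrow> real Matrix.vec \<Rightarrow> real Matrix.vec \<Rightarrow> real" where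
  "distortion p q u v = \<bar>euclid_sqnorm (u - v) / pq_sqnorm p q (u - v)\<bar>"

end

theory Submission
  imports Defs
begin

text \<open>
  The positive and the negative coordinates are treated separately by the Johnson--Lindenstrauss
  lemma with random signs, and the two errors add up to \<open>\<epsilon>\<close> times the Euclidean square norm.
  The random signs are chosen greedily, by the method of conditional expectations: if
  \<open>s' = s \<plusminus> t\<close> with a random sign, then the average of \<open>exp (a s'\<^sup>2)\<close> is
  \<open>exp (a s\<^sup>2 + a t\<^sup>2) cosh (2 a s t) \<le> exp (a t\<^sup>2) exp (a (1 + 2 a t\<^sup>2) s\<^sup>2)\<close>, which is again of the
  same shape with one random sign less. Iterating this over all coordinates bounds the average of
  \<open>exp (a s\<^sup>2)\<close> by \<open>exp (a L + 2 a\<^sup>2 L\<^sup>2)\<close>, where \<open>L\<close> is the square norm of the coefficients, for both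
  signs of \<open>a\<close>; so weighted sums of such exponentials, and hence both tails for all pairs of points
  at once, can be kept below their average.
\<close>

section \<open>A Gaussian bound for the hyperbolic cosine\<close>

lemma two_power_fact_le_fact_double: "2 ^ n * fact n \<le> (fact (2 * n) :: real)"
proof (induction n)
  case (Suc n)
  have "2 ^ Suc n * fact (Suc n) = (2 * (real n + 1)) * (2 ^ n * fact n)"
    by (simp add: algebra_simps)
  also have "\<dots> \<le> (2 * (real n + 1) * (2 * real n + 1)) * fact (2 * n)"
    by (intro mult_mono Suc.IH) (auto simp: algebra_simps)
  also have "\<dots> = fact (2 * Suc n)"
    by (simp add: algebra_simps)
  finally show ?case .
qed simp

text \<open>Termwise comparison of power series: the preceding factorial inequality bounds the term
  of degree \<open>2 * n\<close> of \<open>cosh\<close> by the corresponding term of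
  \<open>exp (x\<^sup>2 / 2)\<close>.\<close>

lemma cosh_le_exp_half_square: "cosh x \<le> exp (x\<^sup>2 / 2)" for x :: real
proof -
  have "(\<lambda>n. if even n then x ^ n /\<^sub>R fact n else 0) sums cosh x"
    by (rule cosh_converges)
  \<comment> \<open>The odd terms vanish, so passing to the even indices does not change the
    limit.\<close>
  then have "(\<lambda>n. if even (2 * n) then x ^ (2 * n) /\<^sub>R fact (2 * n) else 0) sums cosh x"
    by (subst sums_mono_reindex[where g = "\<lambda>n. 2 * n"])
      (auto simp: strict_mono_def elim!: evenE)
  then have *: "(\<lambda>n. x ^ (2 * n) /\<^sub>R fact (2 * n)) sums cosh x"
    by simp
  show ?thesis
  proof (rule sums_le[OF _ * exp_converges])
    fix n
    have "x ^ (2 * n) / fact (2 * n) \<le> x ^ (2 * n) / (2 ^ n * fact n)"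
      by (intro divide_left_mono two_power_fact_le_fact_double) auto
    also have "\<dots> = (x\<^sup>2 / 2) ^ n / fact n"
      by (simp add: power_mult power_divide)
    finally show "x ^ (2 * n) /\<^sub>R fact (2 * n) \<le> (x\<^sup>2 / 2) ^ n /\<^sub>R fact n"
      by (simp only: divide_inverse real_scaleR_def mult.commute)
  qed
qed

section \<open>Averaging over one random sign\<close>

text \<open>The right-hand side is arranged for iteration: \<open>exp (a * t\<^sup>2)\<close> can
  move into a weight, and the other factor is again the exponential of a coefficient times
  \<open>s\<^sup>2\<close>.\<close>

lemma exp_square_sign_average_le:
  fixes a s t :: real
  shows "exp (a * (s + t)\<^sup>2) + exp (a * (s - t)\<^sup>2)
    \<le> 2 * (exp (a * t\<^sup>2) * exp (a * (1 + 2 * a * t\<^sup>2) * s\<^sup>2))"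
proof -
  have "a * (s + t)\<^sup>2 = (a * s\<^sup>2 + a * t\<^sup>2) + 2 * a * s * t"
      "a * (s - t)\<^sup>2 = (a * s\<^sup>2 + a * t\<^sup>2) + - (2 * a * s * t)"
    by (simp_all add: power2_eq_square algebra_simps)
  then have "exp (a * (s + t)\<^sup>2) + exp (a * (s - t)\<^sup>2)
      = exp (a * s\<^sup>2 + a * t\<^sup>2) * exp (2 * a * s * t)
        + exp (a * s\<^sup>2 + a * t\<^sup>2) * exp (- (2 * a * s * t))"
    by (simp only: exp_add)
  also have "\<dots> = 2 * exp (a * s\<^sup>2 + a * t\<^sup>2) * cosh (2 * a * s * t)"
    unfolding cosh_field_def by (simp add: algebra_simps)
  also have "\<dots> \<le> 2 * exp (a * s\<^sup>2 + a * t\<^sup>2) * exp ((2 * a * s * t)\<^sup>2 / 2)"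
    by (intro mult_left_mono cosh_le_exp_half_square) auto
  also have "\<dots> = 2 * (exp (a * t\<^sup>2) * exp (a * (1 + 2 * a * t\<^sup>2) * s\<^sup>2))"
    unfolding mult.assoc exp_add[symmetric] by (simp add: algebra_simps power2_eq_square)
  finally show ?thesis .
qed

text \<open>Arithmetic of the induction over the signs: \<open>h\<close> belongs to the coordinate
  averaged out, \<open>L\<close> to the remaining ones. The smallness condition passes to the new
  coefficient \<open>a'\<close>, and the quadratic term of the target exponent pays for the
  averaging.\<close>

lemma sign_step_exponent_le:
  fixes a L h :: real
  assumes "0 \<le> L" "0 \<le> h" "\<bar>a\<bar> * (L + h) \<le> 1/4"
  defines "a' \<equiv> a * (1 + 2 * a * h)"
  shows "\<bar>a'\<bar> * L \<le> 1/4"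
    and "a * h + (a' * L + 2 * a'\<^sup>2 * L\<^sup>2) \<le> a * (L + h) + 2 * a\<^sup>2 * (L + h)\<^sup>2"
proof -
  have aL: "\<bar>a\<bar> * L \<le> 1/4" and ah: "\<bar>a\<bar> * h \<le> 1/4"
    using assms(1-3) mult_nonneg_nonneg[of "\<bar>a\<bar>" L] mult_nonneg_nonneg[of "\<bar>a\<bar>" h]
    unfolding distrib_left by linarith+
  have "\<bar>a'\<bar> * L \<le> (\<bar>a\<bar> * (1 + 2 * (\<bar>a\<bar> * h))) * L"
    unfolding a'_def abs_mult using assms(1,2)
    by (intro mult_right_mono mult_left_mono order.trans[OF abs_triangle_ineq]) (auto simp: abs_mult)
  also have "\<dots> = \<bar>a\<bar> * L + 2 * (\<bar>a\<bar> * h) * (\<bar>a\<bar> * L)"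
    by (simp add: algebra_simps)
  also have "\<dots> \<le> \<bar>a\<bar> * L + 2 * (\<bar>a\<bar> * h) * (1/4)"
    using assms(1,2) by (intro add_left_mono mult_left_mono aL) auto
  also have "\<dots> \<le> 1/4"
    using assms(2,3) mult_nonneg_nonneg[of "\<bar>a\<bar>" h] unfolding distrib_left by linarith
  finally show "\<bar>a'\<bar> * L \<le> 1/4" .
  have "a * L \<le> 1/4"
    using aL assms(1) by (smt (verit) mult_right_mono)
  then have 1: "(a * L) * (a\<^sup>2 * L * h) \<le> 1/4 * (a\<^sup>2 * L * h)"
    using assms(1,2) by (intro mult_right_mono) auto
  have "(\<bar>a\<bar> * L)\<^sup>2 \<le> (1/4)\<^sup>2"
    using assms(1) by (intro power_mono aL) auto
  then have "a\<^sup>2 * L\<^sup>2 \<le> 1/16"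
    by (simp add: power_mult_distrib power_divide)
  then have 2: "(a\<^sup>2 * L\<^sup>2) * (a\<^sup>2 * h\<^sup>2) \<le> 1/16 * (a\<^sup>2 * h\<^sup>2)"
    by (intro mult_right_mono) auto
  \<comment> \<open>The difference equals \<open>2 a\<^sup>2 L h (1 - 4 a L) + 2 a\<^sup>2 h\<^sup>2
    (1 - 4 a\<^sup>2 L\<^sup>2)\<close>. The threshold 1/4 is what makes the first bracket
    nonnegative.\<close>
  have "a * (L + h) + 2 * a\<^sup>2 * (L + h)\<^sup>2 - (a * h + (a' * L + 2 * a'\<^sup>2 * L\<^sup>2))
    = 2 * (a\<^sup>2 * L * h) - 8 * ((a * L) * (a\<^sup>2 * L * h))
      + (2 * (a\<^sup>2 * h\<^sup>2) - 8 * ((a\<^sup>2 * L\<^sup>2) * (a\<^sup>2 * h\<^sup>2)))"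
    unfolding a'_def by (simp add: algebra_simps power2_eq_square)
  moreover have "0 \<le> a\<^sup>2 * h\<^sup>2" by simp
  ultimately show "a * h + (a' * L + 2 * a'\<^sup>2 * L\<^sup>2) \<le> a * (L + h) + 2 * a\<^sup>2 * (L + h)\<^sup>2"
    using 1 2 by linarith
qed

section \<open>Choosing signs by conditional expectations\<close>

text \<open>Induction on the number of coordinates. Weights and coefficients are generalised because
  averaging over a sign changes both.\<close>

lemma exists_signs_weighted_exp_le:
  fixes w a :: "'a \<Rightarrow> real" and u :: "'a \<Rightarrow> nat \<Rightarrow> real"
  assumes "\<And>v. v \<in> V \<Longrightarrow> 0 \<le> w v"
    and "\<And>v. v \<in> V \<Longrightarrow> \<bar>a v\<bar> * (\<Sum>i<d. (u v i)\<^sup>2) \<le> 1/4"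
  shows "\<exists>e :: nat \<Rightarrow> real. (\<Sum>v\<in>V. w v * exp (a v * (\<Sum>i<d. e i * u v i)\<^sup>2))
    \<le> (\<Sum>v\<in>V. w v * exp (a v * (\<Sum>i<d. (u v i)\<^sup>2) + 2 * (a v)\<^sup>2 * (\<Sum>i<d. (u v i)\<^sup>2)\<^sup>2))"
  using assms
proof (induction d arbitrary: w a)
  case (Suc d)
  define L where "L v = (\<Sum>i<d. (u v i)\<^sup>2)" for v
  define h where "h v = (u v d)\<^sup>2" for v
  define a' where "a' v = a v * (1 + 2 * a v * h v)" for v
  define w' where "w' v = w v * exp (a v * h v)" for v
  have nonneg: "0 \<le> L v" "0 \<le> h v" for v
    by (auto simp: L_def h_def sum_nonneg)
  have small: "\<bar>a v\<bar> * (L v + h v) \<le> 1/4" if "v \<in> V" for v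
    using Suc.prems(2)[OF that] by (simp add: L_def h_def)
  have step: "\<bar>a' v\<bar> * L v \<le> 1/4"
      "a v * h v + (a' v * L v + 2 * (a' v)\<^sup>2 * (L v)\<^sup>2)
        \<le> a v * (L v + h v) + 2 * (a v)\<^sup>2 * (L v + h v)\<^sup>2" if "v \<in> V" for v
    using sign_step_exponent_le[OF nonneg small[OF that]] unfolding a'_def by auto
  \<comment> \<open>The first \<open>d\<close> signs are chosen for the sum in which the last sign
    is already averaged out; only then is the last one fixed.\<close>
  obtain e :: "nat \<Rightarrow> real" where e: "(\<Sum>v\<in>V. w' v * exp (a' v * (\<Sum>i<d. e i * u v i)\<^sup>2))
      \<le> (\<Sum>v\<in>V. w' v * exp (a' v * L v + 2 * (a' v)\<^sup>2 * (L v)\<^sup>2))"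
    using Suc.IH[of w' a'] Suc.prems(1) step(1) unfolding L_def w'_def by auto
  define s where "s v = (\<Sum>i<d. e i * u v i)" for v
  define F where "F c = (\<Sum>v\<in>V. w v * exp (a v * (s v + c * u v d)\<^sup>2))" for c :: real
  define B where "B = (\<Sum>v\<in>V. w v * exp (a v * (L v + h v) + 2 * (a v)\<^sup>2 * (L v + h v)\<^sup>2))"
  have "F 1 + F (-1)
      = (\<Sum>v\<in>V. w v * (exp (a v * (s v + u v d)\<^sup>2) + exp (a v * (s v - u v d)\<^sup>2)))"
    by (simp add: F_def sum.distrib distrib_left)
  also have "\<dots> \<le> (\<Sum>v\<in>V. w v * (2 * (exp (a v * h v) * exp (a' v * (s v)\<^sup>2))))"
    unfolding a'_def h_def using Suc.prems(1)
    by (intro sum_mono mult_left_mono exp_square_sign_average_le) auto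
  also have "\<dots> = 2 * (\<Sum>v\<in>V. w' v * exp (a' v * (s v)\<^sup>2))"
    by (simp add: w'_def sum_distrib_left mult_ac)
  also have "\<dots> \<le> 2 * (\<Sum>v\<in>V. w' v * exp (a' v * L v + 2 * (a' v)\<^sup>2 * (L v)\<^sup>2))"
    using e unfolding s_def by simp
  also have "\<dots> \<le> 2 * B"
    unfolding B_def w'_def using Suc.prems(1) step(2)
    by (auto intro!: sum_mono mult_left_mono simp: mult.assoc simp flip: exp_add)
  \<comment> \<open>At least one of two numbers is at most their average.\<close>
  finally have "F 1 \<le> B \<or> F (-1) \<le> B" by linarith
  then obtain c where "F c \<le> B" by blast
  then show ?case
    by (intro exI[of _ "e(d := c)"]) (simp add: F_def B_def s_def L_def h_def)
qed simp

text \<open>The exponential of a sum over rows is a product, so each row contributes one factor of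
  the single-row bound. Here only the weights change in the induction.\<close>

lemma exists_rows_weighted_exp_le:
  fixes w a :: "'a \<Rightarrow> real" and u :: "'a \<Rightarrow> nat \<Rightarrow> real" and d :: nat
  defines "L \<equiv> \<lambda>v. \<Sum>i<d. (u v i)\<^sup>2"
  assumes "\<And>v. v \<in> V \<Longrightarrow> 0 \<le> w v"
    and "\<And>v. v \<in> V \<Longrightarrow> \<bar>a v\<bar> * L v \<le> 1/4"
  shows "\<exists>R :: nat \<Rightarrow> nat \<Rightarrow> real.
    (\<Sum>v\<in>V. w v * exp (a v * (\<Sum>r<m. (\<Sum>i<d. R r i * u v i)\<^sup>2)))
      \<le> (\<Sum>v\<in>V. w v * exp (real m * (a v * L v + 2 * (a v)\<^sup>2 * (L v)\<^sup>2)))"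
  using assms(2)
proof (induction m arbitrary: w)
  case (Suc m)
  define b where "b v = a v * L v + 2 * (a v)\<^sup>2 * (L v)\<^sup>2" for v
  \<comment> \<open>The extra factor \<open>exp (b v)\<close> anticipates the bound for the row that
    is still to be chosen.\<close>
  obtain R :: "nat \<Rightarrow> nat \<Rightarrow> real" where
    R: "(\<Sum>v\<in>V. w v * exp (b v) * exp (a v * (\<Sum>r<m. (\<Sum>i<d. R r i * u v i)\<^sup>2)))
      \<le> (\<Sum>v\<in>V. w v * exp (b v) * exp (real m * b v))"
    using Suc.IH[of "\<lambda>v. w v * exp (b v)"] Suc.prems unfolding b_def by auto
  define S where "S v = (\<Sum>r<m. (\<Sum>i<d. R r i * u v i)\<^sup>2)" for v
  \<comment> \<open>Once the first \<open>m\<close> rows are fixed, their exponential is part of the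
    weight for the last row.\<close>
  obtain e :: "nat \<Rightarrow> real" where
    e: "(\<Sum>v\<in>V. w v * exp (a v * S v) * exp (a v * (\<Sum>i<d. e i * u v i)\<^sup>2))
      \<le> (\<Sum>v\<in>V. w v * exp (a v * S v) * exp (b v))"
    using exists_signs_weighted_exp_le[where V = V and w = "\<lambda>v. w v * exp (a v * S v)" and a = a and d = d and u = u]
      Suc.prems assms(3)
    unfolding b_def L_def by auto
  have "(\<Sum>v\<in>V. w v * exp (a v * (\<Sum>r<Suc m. (\<Sum>i<d. (R(m := e)) r i * u v i)\<^sup>2)))
      = (\<Sum>v\<in>V. w v * exp (a v * S v) * exp (a v * (\<Sum>i<d. e i * u v i)\<^sup>2))"
    by (simp add: S_def distrib_left exp_add mult.assoc)
  also have "\<dots> \<le> (\<Sum>v\<in>V. w v * exp (b v) * exp (a v * S v))"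
    using e by (simp add: mult_ac)
  also have "\<dots> \<le> (\<Sum>v\<in>V. w v * exp (b v) * exp (real m * b v))"
    using R unfolding S_def .
  also have "\<dots> = (\<Sum>v\<in>V. w v * exp (real (Suc m) * b v))"
    by (simp add: distrib_right exp_add mult.assoc)
  finally show ?case
    unfolding b_def by blast
qed simp

section \<open>The Johnson--Lindenstrauss lemma for finitely many vectors\<close>

text \<open>A derandomised Chernoff and union bound: one sum of exponentials collects both tails of
  all vectors, and keeping it small controls every term.\<close>

lemma Johnson_Lindenstrauss_rows:
  fixes u :: "'a \<Rightarrow> nat \<Rightarrow> real" and d :: nat and \<epsilon> :: real
  defines "L \<equiv> \<lambda>v. \<Sum>i<d. (u v i)\<^sup>2"
  assumes "finite V" "0 < \<epsilon>" "\<epsilon> \<le> 1" and m: "8 * ln (2 * real (card V)) \<le> real m * \<epsilon>\<^sup>2"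
  shows "\<exists>R :: nat \<Rightarrow> nat \<Rightarrow> real. \<forall>v\<in>V.
    \<bar>(\<Sum>r<m. (\<Sum>i<d. R r i * u v i)\<^sup>2) - real m * L v\<bar> \<le> \<epsilon> * real m * L v"
proof -
  define W where "W = V \<times> {1, -1 :: real}"
  \<comment> \<open>The sign \<sigma> selects the tail. The value \<open>\<epsilon> / 4\<close> of
    \<open>\<bar>a\<bar> * L\<close> minimises
    \<open>2 \<theta>\<^sup>2 - \<epsilon> \<theta>\<close> over \<theta> and is at most 1/4. If
    \<open>L v = 0\<close>, division by zero gives the harmless coefficient 0.\<close>
  define a where "a = (\<lambda>(v, \<sigma>). \<sigma> * \<epsilon> / 4 / L v)"
  \<comment> \<open>This weight cancels the linear part of the exponent, so that only the term
    \<open>2 * (a z * L (fst z))\<^sup>2\<close> remains for each row.\<close>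
  define w where "w = (\<lambda>z. exp (- (real m * (a z * L (fst z)))))"
  have L_nonneg: "0 \<le> L v" for v
    by (simp add: L_def sum_nonneg)
  have "\<bar>a z\<bar> * L (fst z) \<le> 1/4" if "z \<in> W" for z
    using that \<open>0 < \<epsilon>\<close> \<open>\<epsilon> \<le> 1\<close> L_nonneg by (auto simp: W_def a_def abs_mult)
  then obtain R :: "nat \<Rightarrow> nat \<Rightarrow> real" where R:
    "(\<Sum>z\<in>W. w z * exp (a z * (\<Sum>r<m. (\<Sum>i<d. R r i * u (fst z) i)\<^sup>2)))
      \<le> (\<Sum>z\<in>W. w z * exp (real m * (a z * L (fst z) + 2 * (a z)\<^sup>2 * (L (fst z))\<^sup>2)))"
    using exists_rows_weighted_exp_le[where V = W and w = w and a = a and d = d and u = "\<lambda>z. u (fst z)" and m = m]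
    unfolding L_def w_def by auto
  define S where "S v = (\<Sum>r<m. (\<Sum>i<d. R r i * u v i)\<^sup>2)" for v
  have "(\<Sum>z\<in>W. w z * exp (real m * (a z * L (fst z) + 2 * (a z)\<^sup>2 * (L (fst z))\<^sup>2)))
      \<le> (\<Sum>z\<in>W. exp (real m * \<epsilon>\<^sup>2 / 8))"
  proof (rule sum_mono)
    fix z assume "z \<in> W"
    then have "(a z * L (fst z))\<^sup>2 \<le> (\<epsilon> / 4)\<^sup>2"
      by (intro power2_le_iff_abs_le[THEN iffD2])
        (use \<open>0 < \<epsilon>\<close> in \<open>auto simp: W_def a_def\<close>)
    then have "real m * (2 * (a z * L (fst z))\<^sup>2) \<le> real m * (2 * (\<epsilon> / 4)\<^sup>2)"
      by (intro mult_left_mono) auto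
    then show "w z * exp (real m * (a z * L (fst z) + 2 * (a z)\<^sup>2 * (L (fst z))\<^sup>2))
        \<le> exp (real m * \<epsilon>\<^sup>2 / 8)"
      by (simp add: w_def power_mult_distrib power_divide algebra_simps flip: exp_add)
  qed
  also have "\<dots> = 2 * real (card V) * exp (real m * \<epsilon>\<^sup>2 / 8)"
    using \<open>finite V\<close> by (simp add: W_def card_cartesian_product)
  finally have total: "(\<Sum>z\<in>W. w z * exp (a z * S (fst z)))
      \<le> 2 * real (card V) * exp (real m * \<epsilon>\<^sup>2 / 8)"
    using R unfolding S_def by linarith
  have "\<bar>S v - real m * L v\<bar> \<le> \<epsilon> * real m * L v" if "v \<in> V" for v
  proof (cases "L v = 0")
    case True
    then have "\<forall>i<d. u v i = 0"
      by (auto simp: L_def sum_nonneg_eq_0_iff)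
    then show ?thesis
      using True by (simp add: S_def)
  next
    case False
    then have L_pos: "0 < L v"
      using L_nonneg[of v] by simp
    have card_pos: "0 < card V"
      using that \<open>finite V\<close> by (auto simp: card_gt_0_iff)
    have tail: "\<sigma> * (S v - real m * L v) \<le> \<epsilon> * real m * L v" if "\<sigma> \<in> {1, -1}" for \<sigma> :: real
    proof -
      let ?z = "(v, \<sigma>)"
      have "exp (\<sigma> * \<epsilon> / 4 * (S v / L v - real m)) = w ?z * exp (a ?z * S (fst ?z))"
        using L_pos by (simp add: w_def a_def field_simps flip: exp_add)
      \<comment> \<open>All summands are nonnegative, so the bound on the sum bounds each of them;
        this replaces the union bound.\<close>
      also have "\<dots> \<le> (\<Sum>z\<in>W. w z * exp (a z * S (fst z)))"
        using \<open>v \<in> V\<close> that \<open>finite V\<close>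
        by (intro member_le_sum) (auto simp: W_def w_def)
      also have "\<dots> \<le> 2 * real (card V) * exp (real m * \<epsilon>\<^sup>2 / 8)"
        by (rule total)
      also have "\<dots> = exp (ln (2 * real (card V)) + real m * \<epsilon>\<^sup>2 / 8)"
        using card_pos by (simp add: exp_add)
      finally have "\<sigma> * \<epsilon> / 4 * (S v / L v - real m)
          \<le> ln (2 * real (card V)) + real m * \<epsilon>\<^sup>2 / 8"
        by simp
      \<comment> \<open>The lower bound on \<open>m\<close> makes the logarithm at most
        \<open>real m * \<epsilon>\<^sup>2 / 8\<close>, as large as the second-order term.\<close>
      also have "\<dots> \<le> real m * \<epsilon>\<^sup>2 / 4"
        using m by simp
      finally have "\<epsilon> / 4 * (\<sigma> * (S v / L v - real m)) \<le> \<epsilon> / 4 * (\<epsilon> * real m)"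
        by (simp add: power2_eq_square mult_ac)
      then have "\<sigma> * (S v / L v - real m) \<le> \<epsilon> * real m"
        using \<open>0 < \<epsilon>\<close> by simp
      then have "\<sigma> * (S v / L v - real m) * L v \<le> \<epsilon> * real m * L v"
        using L_pos by (intro mult_right_mono) auto
      then show ?thesis
        using L_pos by (simp add: algebra_simps)
    qed
    show ?thesis
      using tail[of 1] tail[of "-1"] by (simp add: abs_le_iff)
  qed
  then show ?thesis
    unfolding S_def by blast
qed

section \<open>Embedding of the indefinite space\<close>

text \<open>The form is a difference of two Euclidean square norms; projecting each part separately
  gives errors that add up to a multiple of their sum. This bound involves no division, so it holds
  for null differences as well.\<close>

lemma pq_Johnson_Lindenstrauss:
  fixes x :: "'a \<Rightarrow> real Matrix.vec" and \<epsilon> :: real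
  assumes "finite I" and x: "\<And>i. i \<in> I \<Longrightarrow> x i \<in> pq_space p q" and "0 < \<epsilon>" "\<epsilon> \<le> 1"
    and m: "0 < m" "8 * ln (2 * (real (card I))\<^sup>2) \<le> real m * \<epsilon>\<^sup>2"
  shows "\<exists>f. f \<in> pq_space p q \<rightarrow> pq_space m m \<and> (\<forall>i\<in>I. \<forall>j\<in>I.
    \<bar>pq_sqnorm m m (f (x i) - f (x j)) - pq_sqnorm p q (x i - x j)\<bar>
      \<le> \<epsilon> * euclid_sqnorm (x i - x j))"
proof -
  \<comment> \<open>The vectors to be preserved are the differences of all ordered pairs, whence the
    square of \<open>card I\<close> in the bound on \<open>m\<close>.\<close>
  define V where "V = I \<times> I"
  define y where "y = (\<lambda>(i, j). x i - x j)"
  have V: "finite V" "8 * ln (2 * real (card V)) \<le> real m * \<epsilon>\<^sup>2"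
    using m(2) \<open>finite I\<close> by (auto simp: V_def card_cartesian_product power2_eq_square)
  obtain P :: "nat \<Rightarrow> nat \<Rightarrow> real" where P: "\<And>v. v \<in> V \<Longrightarrow>
      \<bar>(\<Sum>r<m. (\<Sum>i<p. P r i * y v $ i)\<^sup>2) - real m * (\<Sum>i<p. (y v $ i)\<^sup>2)\<bar>
        \<le> \<epsilon> * real m * (\<Sum>i<p. (y v $ i)\<^sup>2)"
    using Johnson_Lindenstrauss_rows[OF V(1) assms(3,4) V(2), where d = p and u = "\<lambda>v i. y v $ i"]
    by blast
  obtain Q :: "nat \<Rightarrow> nat \<Rightarrow> real" where Q: "\<And>v. v \<in> V \<Longrightarrow>
      \<bar>(\<Sum>r<m. (\<Sum>i<q. Q r i * y v $ (p + i))\<^sup>2) - real m * (\<Sum>i<q. (y v $ (p + i))\<^sup>2)\<bar>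
        \<le> \<epsilon> * real m * (\<Sum>i<q. (y v $ (p + i))\<^sup>2)"
    using Johnson_Lindenstrauss_rows[OF V(1) assms(3,4) V(2), where d = q and u = "\<lambda>v i. y v $ (p + i)"]
    by blast
  \<comment> \<open>The linear map stacking \<open>P\<close> on the positive and \<open>Q\<close> on
    the negative coordinates; \<open>sqrt m\<close> removes the factor \<open>real m\<close> from
    the square norms.\<close>
  define f where "f z = Matrix.vec (m + m) (\<lambda>r.
    (if r < m then \<Sum>i<p. P r i * z $ i else \<Sum>i<q. Q (r - m) i * z $ (p + i)) / sqrt m)"
    for z :: "real Matrix.vec"
  have shift: "(\<Sum>i=k..<k + l. g i) = (\<Sum>i<l. g (k + i))" for g :: "nat \<Rightarrow> real" and k l
    using sum.shift_bounds_nat_ivl[of g 0 k l] by (simp add: atLeast0LessThan add.commute)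
  have split: "(\<Sum>i<k + l. g i) = (\<Sum>i<k. g i) + (\<Sum>i<l. g (k + i))"
    for g :: "nat \<Rightarrow> real" and k l
    by (induction l) auto
  have "\<bar>pq_sqnorm m m (f (x i) - f (x j)) - pq_sqnorm p q (x i - x j)\<bar>
      \<le> \<epsilon> * euclid_sqnorm (x i - x j)" if "i \<in> I" "j \<in> I" for i j
  proof -
    let ?v = "(i, j)"
    have dims: "dim_vec (x i) = p + q" "dim_vec (x j) = p + q"
      using x that by (auto simp: pq_space_def)
    have v: "?v \<in> V" using that by (simp add: V_def)
    define A where "A = (\<Sum>r<m. (\<Sum>i<p. P r i * y ?v $ i)\<^sup>2)"
    define B where "B = (\<Sum>r<m. (\<Sum>i<q. Q r i * y ?v $ (p + i))\<^sup>2)"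
    define A' where "A' = (\<Sum>i<p. (y ?v $ i)\<^sup>2)"
    define B' where "B' = (\<Sum>i<q. (y ?v $ (p + i))\<^sup>2)"
    have A_term: "((f (x i) - f (x j)) $ r)\<^sup>2 = (\<Sum>i<p. P r i * y ?v $ i)\<^sup>2 / real m"
      if "r < m" for r
      using that dims
      by (simp add: f_def y_def power_divide right_diff_distrib sum_subtractf
        flip: diff_divide_distrib)
    have B_term: "((f (x i) - f (x j)) $ (m + r))\<^sup>2 = (\<Sum>i<q. Q r i * y ?v $ (p + i))\<^sup>2 / real m"
      if "r < m" for r
      using that dims
      by (simp add: f_def y_def power_divide right_diff_distrib sum_subtractf
        flip: diff_divide_distrib)
    have 1: "pq_sqnorm m m (f (x i) - f (x j)) = A / real m - B / real m"
      using A_term B_term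
      by (simp add: pq_sqnorm_def pq_form_def shift A_def B_def sum_divide_distrib
        flip: power2_eq_square)
    have 2: "pq_sqnorm p q (x i - x j) = A' - B'"
      by (simp add: pq_sqnorm_def pq_form_def shift A'_def B'_def y_def flip: power2_eq_square)
    have 3: "euclid_sqnorm (x i - x j) = A' + B'"
      using dims by (simp add: euclid_sqnorm_def split A'_def B'_def y_def)
    have "\<bar>A - real m * A'\<bar> / real m \<le> \<epsilon> * real m * A' / real m"
      using P[OF v] unfolding A_def A'_def by (intro divide_right_mono) auto
    then have A: "\<bar>A / real m - A'\<bar> \<le> \<epsilon> * A'"
      using m(1) by (simp add: diff_divide_distrib mult_ac abs_div_pos)
    have "\<bar>B - real m * B'\<bar> / real m \<le> \<epsilon> * real m * B' / real m"
      using Q[OF v] unfolding B_def B'_def by (intro divide_right_mono) auto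
    then have B: "\<bar>B / real m - B'\<bar> \<le> \<epsilon> * B'"
      using m(1) by (simp add: diff_divide_distrib mult_ac abs_div_pos)
    show ?thesis
      using A B unfolding 1 2 3 distrib_left by linarith
  qed
  moreover have "f \<in> pq_space p q \<rightarrow> pq_space m m"
    by (auto simp: f_def pq_space_def)
  ultimately show ?thesis by blast
qed

section \<open>Size of the target dimension\<close>

text \<open>The constant is 26 = 8 * 3 + 2: the logarithm is at most \<open>3 * ln (real n)\<close>
  since 2 \<le> n, and rounding up costs at most 1, which is at most
  \<open>2 * ln (real n)\<close>.\<close>

lemma exists_target_dimension:
  fixes \<epsilon> :: real
  assumes "2 \<le> n" "0 < \<epsilon>" "\<epsilon> \<le> 1"
  shows "\<exists>m. 0 < m \<and> 8 * ln (2 * (real n)\<^sup>2) \<le> real m * \<epsilon>\<^sup>2 \<and> real m \<le> 26 * ln (real n) / \<epsilon>\<^sup>2"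
proof -
  define t where "t = 8 * ln (2 * (real n)\<^sup>2) / \<epsilon>\<^sup>2"
  have eps: "0 < \<epsilon>\<^sup>2" "\<epsilon>\<^sup>2 \<le> 1"
    using assms by (auto simp: power_le_one)
  have "exp (1/2) \<le> real n"
    using exp_half_le2 assms(1) by linarith
  then have half: "1/2 \<le> ln (real n)"
    using assms(1) by (subst ln_ge_iff) auto
  have "ln (2 * (real n)\<^sup>2) = ln 2 + 2 * ln (real n)"
    using assms(1) by (simp add: ln_mult ln_realpow)
  moreover have "0 < ln (2::real)" "ln 2 \<le> ln (real n)"
    using assms(1) by auto
  ultimately have ln: "0 < ln (2 * (real n)\<^sup>2)" "ln (2 * (real n)\<^sup>2) \<le> 3 * ln (real n)"
    using half by linarith+
  have t: "0 < t" using ln eps by (simp add: t_def)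
  define m where "m = nat \<lceil>t\<rceil>"
  have m: "t \<le> real m" "real m \<le> t + 1"
    unfolding m_def using t by linarith+
  have "t * \<epsilon>\<^sup>2 \<le> real m * \<epsilon>\<^sup>2"
    using m eps by (intro mult_right_mono) auto
  then have "8 * ln (2 * (real n)\<^sup>2) \<le> real m * \<epsilon>\<^sup>2"
    using eps by (simp add: t_def)
  moreover have "real m * \<epsilon>\<^sup>2 \<le> (t + 1) * \<epsilon>\<^sup>2"
    using m eps by (intro mult_right_mono) auto
  then have "real m * \<epsilon>\<^sup>2 \<le> 26 * ln (real n)"
    using eps ln half by (simp add: t_def distrib_right)
  then have "real m \<le> 26 * ln (real n) / \<epsilon>\<^sup>2"
    using eps by (simp add: pos_le_divide_eq)
  moreover have "0 < m"
    using t m by (cases m) auto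
  ultimately show ?thesis by blast
qed

section \<open>Passage to the relative error\<close>

text \<open>The endpoints are \<open>N - c * N\<close> and \<open>N + c * N\<close>. Their order
  depends on the sign of \<open>c * N\<close>, hence \<open>min\<close> and
  \<open>max\<close>.\<close>

lemma between_of_abs_diff_le:
  fixes N N' c :: real
  assumes "\<bar>N' - N\<bar> \<le> c * \<bar>N\<bar>"
  shows "min ((1 - c) * N) ((1 + c) * N) \<le> N'" "N' \<le> max ((1 - c) * N) ((1 + c) * N)"
proof -
  have "(1 - c) * N = N - c * N" "(1 + c) * N = N + c * N"
    by (simp_all add: algebra_simps)
  moreover have "\<bar>N' - N\<bar> \<le> \<bar>c * N\<bar>"
    using assms abs_ge_self[of "c * \<bar>N\<bar>"] by (simp add: abs_mult)
  ultimately show "min ((1 - c) * N) ((1 + c) * N) \<le> N'" "N' \<le> max ((1 - c) * N) ((1 + c) * N)"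
    by linarith+
qed

theorem theorem3:
  "\<exists>K::real. 0 < K \<and>
     (\<forall>(p::nat) (q::nat) (n::nat) x (\<epsilon>::real).
        2 \<le> n \<and> (\<forall>i\<in>{1..n}. x (i::nat) \<in> pq_space p q) \<and> 0 < \<epsilon> \<and> \<epsilon> < 1 \<longrightarrow>
        (\<exists>(p'::nat) (q'::nat) f.
           real p' \<le> K * ln (real n) / \<epsilon>\<^sup>2 \<and>
           real q' \<le> K * ln (real n) / \<epsilon>\<^sup>2 \<and>
           f \<in> pq_space p q \<rightarrow> pq_space p' q' \<and>
           (\<forall>i\<in>{1..n}. \<forall>j\<in>{1..n}.
              pq_sqnorm p q (x i - x j) \<noteq> 0 \<longrightarrow>
              (let C = distortion p q (x i) (x j);
                   N = pq_sqnorm p q (x i - x j);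
                   N' = pq_sqnorm p' q' (f (x i) - f (x j))
               in \<bar>N' - N\<bar> \<le> \<epsilon> * C * \<bar>N\<bar> \<and>
                  min ((1 - \<epsilon> * C) * N) ((1 + \<epsilon> * C) * N) \<le> N' \<and>
                  N' \<le> max ((1 - \<epsilon> * C) * N) ((1 + \<epsilon> * C) * N)))))"
proof (rule exI[of _ 26], rule conjI[OF _ allI[OF allI[OF allI[OF allI[OF allI[OF impI]]]]]], goal_cases)
  case (2 p q n x \<epsilon>)
  then have n: "2 \<le> n" and x: "\<forall>i\<in>{1..n}. x i \<in> pq_space p q" and \<epsilon>: "0 < \<epsilon>" "\<epsilon> < 1"
    by auto
  \<comment> \<open>A single \<open>m\<close> serves as both \<open>p'\<close> and
    \<open>q'\<close>.\<close>
  obtain m where m: "0 < m" "8 * ln (2 * (real n)\<^sup>2) \<le> real m * \<epsilon>\<^sup>2"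
      "real m \<le> 26 * ln (real n) / \<epsilon>\<^sup>2"
    using exists_target_dimension[OF n \<epsilon>(1)] \<epsilon> by auto
  obtain f where f: "f \<in> pq_space p q \<rightarrow> pq_space m m"
    and bound: "\<And>i j. i \<in> {1..n} \<Longrightarrow> j \<in> {1..n} \<Longrightarrow>
      \<bar>pq_sqnorm m m (f (x i) - f (x j)) - pq_sqnorm p q (x i - x j)\<bar>
        \<le> \<epsilon> * euclid_sqnorm (x i - x j)"
    using pq_Johnson_Lindenstrauss[of "{1..n}" x p q \<epsilon> m] x \<epsilon> m by auto
  have main: "\<bar>pq_sqnorm m m (f (x i) - f (x j)) - pq_sqnorm p q (x i - x j)\<bar>
      \<le> \<epsilon> * distortion p q (x i) (x j) * \<bar>pq_sqnorm p q (x i - x j)\<bar>"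
    if "i \<in> {1..n}" "j \<in> {1..n}" "pq_sqnorm p q (x i - x j) \<noteq> 0" for i j
  proof -
    \<comment> \<open>With a nonzero denominator, the distortion times the absolute value of the
      form is the absolute value of the Euclidean square norm; nonnegativity removes the
      bars.\<close>
    have "0 \<le> euclid_sqnorm (x i - x j)"
      by (simp add: euclid_sqnorm_def sum_nonneg)
    then show ?thesis
      using bound[OF that(1,2)] that(3) by (simp add: distortion_def)
  qed
  show ?case
    unfolding Let_def
    using m(3) f main between_of_abs_diff_le[OF main]
    by (intro exI[of _ m] exI[of _ f] conjI ballI impI)
qed simp

end
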